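(* Let $X$ be a nonempty set, let $\mathcal{F}$ be a family of subsets of $X$ which is closed under intersection and contains $X$, and let $L$ be a complete lattice. Then $$|\mathcal{N}(L,\mathcal{F})|=|\mathcal{S}(L,\mathcal{F})|\cdot|OI(\mathcal{F})|.$$
   Context: $|A|$ denotes the cardinality of a set $A$. For $f:X\to L$ and $p\in L$, $f_p=\{x\in X\mid f(x)\geq p\}$ and $f_L=\{f_p\mid p\in L\}$. $\mathcal{N}(L,\mathcal{F})=\{f\mid f:X\to L,\ f_L=\mathcal{F}\}$ (the $L$-fuzzy sets whose family of cuts is $\mathcal{F}$). For a subset $P\subseteq L$ with the induced order, "$P$ can be embedded into $L$ by $\iota_{(P,L)}$-embedding" means that the inclusion map $P\to L$ preserves all infima and the top element: for every $S\subseteq P$ the infimum of $S$ in $P$ exists and equals its infimum in $L$, and the top of $P$ is $1_L$. $\mathcal{S}(L,\mathcal{F})=\{P\subseteq L\mid P\text{ can be embedded into }L\text{ by }\iota_{(P,L)}\text{-embedding and }(P,\leq)\cong(\mathcal{F},\supseteq)\}$. $OI(\mathcal{F})$ denotes the set of lattice isomorphisms of the lattice $(\mathcal{F},\supseteq)$ onto itself. *)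

theory Defs
  imports "HOL-Algebra.Complete_Lattice" "HOL-Library.FuncSet"
begin

unbundle cardinal_syntax

definition cut :: "'x set \<Rightarrow> ('l, 'm) gorder_scheme \<Rightarrow> ('x \<Rightarrow> 'l) \<Rightarrow> 'l \<Rightarrow> 'x set"
  where "cut X L f p = {x \<in> X. p \<sqsubseteq>\<^bsub>L\<^esub> f x}"

definition cuts :: "'x set \<Rightarrow> ('l, 'm) gorder_scheme \<Rightarrow> ('x \<Rightarrow> 'l) \<Rightarrow> 'x set set"
  where "cuts X L f = {cut X L f p | p. p \<in> carrier L}"

text \<open>Functions between carriers are taken to be extensional, so that the cardinality of a
  set of functions counts each function exactly once.\<close>

definition fuzzy_sets :: "'x set \<Rightarrow> ('l, 'm) gorder_scheme \<Rightarrow> 'x set set \<Rightarrow> ('x \<Rightarrow> 'l) set"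
  where "fuzzy_sets X L F = {f \<in> X \<rightarrow>\<^sub>E carrier L. cuts X L f = F}"

definition rev_incl :: "'x set set \<Rightarrow> 'x set gorder"
  where "rev_incl F = \<lparr>carrier = F, eq = (=), le = (\<lambda>A B. A \<supseteq> B)\<rparr>"

definition order_isomorphic :: "('a, 'c) gorder_scheme \<Rightarrow> ('b, 'd) gorder_scheme \<Rightarrow> bool"
  where "order_isomorphic A B \<longleftrightarrow>
    (\<exists>\<phi>. bij_betw \<phi> (carrier A) (carrier B) \<and> order_emb A B \<phi>)"

definition iota_embeddable :: "'l set \<Rightarrow> ('l, 'm) gorder_scheme \<Rightarrow> bool"
  where "iota_embeddable P L \<longleftrightarrow>
    (\<forall>S \<subseteq> P. is_glb (L\<lparr>carrier := P\<rparr>) (\<Sqinter>\<^bsub>L\<^esub> S) S) \<and>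
    greatest (L\<lparr>carrier := P\<rparr>) \<top>\<^bsub>L\<^esub> P"

definition embeddable_copies :: "('l, 'm) gorder_scheme \<Rightarrow> 'x set set \<Rightarrow> 'l set set"
  where "embeddable_copies L F =
    {P. P \<subseteq> carrier L \<and> iota_embeddable P L \<and>
        order_isomorphic (L\<lparr>carrier := P\<rparr>) (rev_incl F)}"

definition lattice_automorphisms :: "('a, 'c) gorder_scheme \<Rightarrow> ('a \<Rightarrow> 'a) set"
  where "lattice_automorphisms K =
    {\<phi> \<in> extensional (carrier K).
      bij_betw \<phi> (carrier K) (carrier K) \<and> join_pres K K \<phi> \<and> meet_pres K K \<phi>}"

definition OI :: "'x set set \<Rightarrow> ('x set \<Rightarrow> 'x set) set"
  where "OI F = lattice_automorphisms (rev_incl F)"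

end

(* A fuzzy set f with family of cuts F is determined by the order isomorphism A \<mapsto> \<Sqinter>(f ` A) from
   (F, \<supseteq>) onto a subset P of L, because f x is the infimum of f over the least member of F
   containing x. Such subsets P are exactly the ones closed under infima of L and isomorphic to F.
   After fixing one isomorphism for every P, the others correspond to the automorphisms of F. *)
theory Submission
  imports Defs
begin

section \<open>Lattice automorphisms as order automorphisms\<close>

lemma lattice_hom_iff_order_emb:
  fixes K (structure)
  assumes K: "lattice K" and bij: "bij_betw \<phi> (carrier K) (carrier K)"
  shows "join_pres K K \<phi> \<and> meet_pres K K \<phi> \<longleftrightarrow> order_emb K K \<phi>"
proof -
  interpret lattice K by (rule K)
  have cl: "\<phi> x \<in> carrier K" if "x \<in> carrier K" for x
    using bij that by (auto simp: bij_betw_def)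
  show ?thesis
  proof
    assume "join_pres K K \<phi> \<and> meet_pres K K \<phi>"
    then have J: "\<phi> (x \<squnion> y) = \<phi> x \<squnion> \<phi> y" if "x \<in> carrier K" "y \<in> carrier K" for x y
      using that by (auto simp: join_pres_def)
    have "\<phi> x \<sqsubseteq> \<phi> y \<longleftrightarrow> x \<sqsubseteq> y" if xy: "x \<in> carrier K" "y \<in> carrier K" for x y
    proof -
      \<comment> \<open>The order is read off from joins, as an equation that injectivity carries
        back along \<open>\<phi>\<close>.\<close>
      have "\<phi> x \<sqsubseteq> \<phi> y \<longleftrightarrow> \<phi> (x \<squnion> y) = \<phi> y"
        using xy by (simp add: J cl le_iff_meet)
      also have "\<dots> \<longleftrightarrow> x \<squnion> y = y"
        using bij xy by (auto simp: bij_betw_def dest: inj_onD)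
      finally show ?thesis
        using xy by (simp add: le_iff_meet)
    qed
    then show "order_emb K K \<phi>"
      by (simp add: order_emb_def weak_partial_order_axioms)
  next
    assume "order_emb K K \<phi>"
    then have E: "\<phi> x \<sqsubseteq> \<phi> y \<longleftrightarrow> x \<sqsubseteq> y" if "x \<in> carrier K" "y \<in> carrier K" for x y
      using that by (auto simp: order_emb_def)
    have pre: "\<exists>z \<in> carrier K. \<phi> z = w" if "w \<in> carrier K" for w
      using bij_betw_imp_surj_on[OF bij] that by (metis imageE)
    have "\<phi> (x \<squnion> y) = \<phi> x \<squnion> \<phi> y" if xy: "x \<in> carrier K" "y \<in> carrier K" for x y
    proof (rule le_antisym)
      \<comment> \<open>Surjectivity pulls the join of the images back to \<open>z\<close>, an upper
        bound of \<open>x\<close> and \<open>y\<close>. The meet is treated dually below.\<close>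
      obtain z where z: "z \<in> carrier K" "\<phi> z = \<phi> x \<squnion> \<phi> y"
        using pre[OF join_closed[OF cl cl]] xy by blast
      have "x \<sqsubseteq> z" "y \<sqsubseteq> z"
        using E[of x z] E[of y z] xy z cl join_left[of "\<phi> x" "\<phi> y"] join_right[of "\<phi> x" "\<phi> y"]
        by simp_all
      then have "x \<squnion> y \<sqsubseteq> z"
        using xy z by (intro join_le) auto
      then show "\<phi> (x \<squnion> y) \<sqsubseteq> \<phi> x \<squnion> \<phi> y"
        using E[of "x \<squnion> y" z] xy z by auto
      show "\<phi> x \<squnion> \<phi> y \<sqsubseteq> \<phi> (x \<squnion> y)"
        using xy by (intro join_le) (simp_all add: cl E join_left join_right)
    qed (use xy cl in auto)
    moreover have "\<phi> (x \<sqinter> y) = \<phi> x \<sqinter> \<phi> y" if xy: "x \<in> carrier K" "y \<in> carrier K" for x y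
    proof (rule le_antisym)
      obtain z where z: "z \<in> carrier K" "\<phi> z = \<phi> x \<sqinter> \<phi> y"
        using pre[OF meet_closed[OF cl cl]] xy by blast
      have "z \<sqsubseteq> x" "z \<sqsubseteq> y"
        using E[of z x] E[of z y] xy z cl meet_left[of "\<phi> x" "\<phi> y"] meet_right[of "\<phi> x" "\<phi> y"]
        by simp_all
      then have "z \<sqsubseteq> x \<sqinter> y"
        using xy z by (intro meet_le) auto
      then show "\<phi> x \<sqinter> \<phi> y \<sqsubseteq> \<phi> (x \<sqinter> y)"
        using E[of z "x \<sqinter> y"] xy z by auto
      show "\<phi> (x \<sqinter> y) \<sqsubseteq> \<phi> x \<sqinter> \<phi> y"
        using xy by (intro meet_le) (simp_all add: cl E meet_left meet_right)
    qed (use xy cl in auto)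
    ultimately show "join_pres K K \<phi> \<and> meet_pres K K \<phi>"
      using K by (simp add: join_pres_def meet_pres_def)
  qed
qed

section \<open>Reverse inclusion, infima over cuts, and subsets closed under infima\<close>

lemma carrier_rev_incl [simp]: "carrier (rev_incl F) = F"
  and le_rev_incl [simp]: "A \<sqsubseteq>\<^bsub>rev_incl F\<^esub> B \<longleftrightarrow> B \<subseteq> A"
  by (simp_all add: rev_incl_def)

lemma partial_order_rev_incl: "partial_order (rev_incl F)"
  by unfold_locales (auto simp: rev_incl_def)

lemma (in partial_order) partial_order_subset:
  assumes "P \<subseteq> carrier L"
  shows "partial_order (L\<lparr>carrier := P\<rparr>)"
proof unfold_locales
  fix x y z
  assume "x \<sqsubseteq>\<^bsub>L\<lparr>carrier := P\<rparr>\<^esub> y" "y \<sqsubseteq>\<^bsub>L\<lparr>carrier := P\<rparr>\<^esub> z"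
    "x \<in> carrier (L\<lparr>carrier := P\<rparr>)" "y \<in> carrier (L\<lparr>carrier := P\<rparr>)" "z \<in> carrier (L\<lparr>carrier := P\<rparr>)"
  then show "x \<sqsubseteq>\<^bsub>L\<lparr>carrier := P\<rparr>\<^esub> z"
    using le_trans[of x y z] assms by auto
qed (use assms in \<open>auto simp: eq_is_equal\<close>)

text \<open>A Galois connection between subsets of \<open>X\<close> and points of \<open>L\<close>:
  either side says that \<open>p\<close> is below every value of \<open>f\<close> on
  \<open>A\<close>. The later computations with cuts rest on it.\<close>

lemma (in complete_lattice) le_inf_image_iff:
  assumes "f \<in> X \<rightarrow> carrier L" "A \<subseteq> X" "p \<in> carrier L"
  shows "p \<sqsubseteq> \<Sqinter> (f ` A) \<longleftrightarrow> A \<subseteq> cut X L f p"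
proof -
  have fA: "f ` A \<subseteq> carrier L"
    using assms by auto
  have "p \<sqsubseteq> f x" if "p \<sqsubseteq> \<Sqinter> (f ` A)" "x \<in> A" for x
    using that fA assms(3) inf_lower[OF fA, of "f x"] inf_closed[OF fA]
    by (meson imageI le_trans subsetD)
  moreover have "p \<sqsubseteq> \<Sqinter> (f ` A)" if "\<And>x. x \<in> A \<Longrightarrow> p \<sqsubseteq> f x"
    using that fA assms(3) by (intro inf_greatest) auto
  ultimately have "p \<sqsubseteq> \<Sqinter> (f ` A) \<longleftrightarrow> (\<forall>x \<in> A. p \<sqsubseteq> f x)"
    by blast
  then show ?thesis
    using assms(2) by (auto simp: cut_def)
qed

text \<open>A greatest lower bound in \<open>P\<close> must belong to \<open>P\<close>; conversely
  an infimum of \<open>L\<close> that lies in \<open>P\<close> remains the infimum there. The top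
  element is the infimum of the empty set.\<close>

lemma (in complete_lattice) iota_embeddable_iff:
  assumes P: "P \<subseteq> carrier L"
  shows "iota_embeddable P L \<longleftrightarrow> (\<forall>S \<subseteq> P. \<Sqinter> S \<in> P)"
proof
  assume "iota_embeddable P L"
  then show "\<forall>S \<subseteq> P. \<Sqinter> S \<in> P"
    by (auto simp: iota_embeddable_def greatest_def Lower_def)
next
  assume inf: "\<forall>S \<subseteq> P. \<Sqinter> S \<in> P"
  have "is_glb (L\<lparr>carrier := P\<rparr>) (\<Sqinter> S) S" if S: "S \<subseteq> P" for S
  proof -
    have "x \<sqsubseteq> \<Sqinter> S" if "x \<in> P" "\<And>s. s \<in> S \<Longrightarrow> x \<sqsubseteq> s" for x
      using that S P by (intro inf_greatest) auto
    moreover have "\<Sqinter> S \<sqsubseteq> s" if "s \<in> S" for s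
      using that S P by (intro inf_lower) auto
    ultimately show ?thesis
      using S inf unfolding greatest_def Lower_def by (simp add: Ball_def) blast
  qed
  moreover have "\<top> \<in> P"
    using inf[rule_format, of "{}"] weak_inf_empty by (simp add: eq_is_equal)
  ultimately show "iota_embeddable P L"
    using P by (auto simp: iota_embeddable_def greatest_def intro: top_higher)
qed

section \<open>Parametrized copies of \<open>F\<close> in \<open>L\<close> and the fuzzy sets built
  from them\<close>

locale fuzzy_cuts = complete_lattice L for L :: "('l, 'm) gorder_scheme" (structure) +
  fixes X :: "'x set" and F :: "'x set set"
  assumes F_Pow: "F \<subseteq> Pow X"
    and F_Inter: "\<And>G. G \<subseteq> F \<Longrightarrow> G \<noteq> {} \<Longrightarrow> \<Inter>G \<in> F"
    and X_F: "X \<in> F"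
begin

text \<open>The closure of a point in the closure system \<open>F\<close>. Outside \<open>X\<close>
  the family is empty and its intersection is the whole type, so membership in \<open>F\<close> is
  claimed only on \<open>X\<close>.\<close>

definition hull_pt :: "'x \<Rightarrow> 'x set"
  where "hull_pt x = \<Inter>{A \<in> F. x \<in> A}"

text \<open>These maps start at \<open>F\<close>, against the direction in
  \<open>order_isomorphic\<close>, so that automorphisms of \<open>F\<close> act on them by
  composition. Injectivity follows from antisymmetry of inclusion. Values outside \<open>F\<close>
  stay arbitrary.\<close>

definition parametrizes :: "('x set \<Rightarrow> 'l) \<Rightarrow> 'l set \<Rightarrow> bool"
  where "parametrizes \<psi> P \<longleftrightarrow> \<psi> ` F = P \<and> (\<forall>A \<in> F. \<forall>B \<in> F. \<psi> A \<sqsubseteq> \<psi> B \<longleftrightarrow> B \<subseteq> A)"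

text \<open>The formula makes the cut at \<open>\<psi> A\<close> equal to \<open>A\<close> when
  \<open>\<psi>\<close> parametrizes some \<open>P\<close>: \<open>\<psi> A\<close> is below the
  value at \<open>x\<close> iff \<open>hull_pt x\<close> is contained in \<open>A\<close>, that is,
  iff \<open>x\<close> lies in \<open>A\<close>.\<close>

definition fuzzy_of :: "('x set \<Rightarrow> 'l) \<Rightarrow> 'x \<Rightarrow> 'l"
  where "fuzzy_of \<psi> = (\<lambda>x \<in> X. \<psi> (hull_pt x))"

lemma hull_pt_in: "x \<in> X \<Longrightarrow> hull_pt x \<in> F"
  unfolding hull_pt_def using X_F by (intro F_Inter) auto

lemma hull_pt_subset_iff: "A \<in> F \<Longrightarrow> hull_pt x \<subseteq> A \<longleftrightarrow> x \<in> A"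
  by (auto simp: hull_pt_def)

text \<open>With the order reversed, intersections are joins, while the meet is the closure of the
  union; the latter exists because \<open>X\<close> is a member of \<open>F\<close> above the
  union.\<close>

lemma lattice_rev_incl: "lattice (rev_incl F)"
proof -
  interpret R: partial_order "rev_incl F" by (rule partial_order_rev_incl)
  show ?thesis
  proof
    fix A B assume "A \<in> carrier (rev_incl F)" "B \<in> carrier (rev_incl F)"
    then have AB: "A \<in> F" "B \<in> F" by simp_all
    have "A \<inter> B \<in> F"
      using F_Inter[of "{A, B}"] AB by simp
    then show "\<exists>s. least (rev_incl F) s (Upper (rev_incl F) {A, B})"
      using AB by (intro exI[of _ "A \<inter> B"]) (auto simp: least_def Upper_def)
    have "\<Inter>{C \<in> F. A \<union> B \<subseteq> C} \<in> F"
      using AB F_Pow X_F by (intro F_Inter) auto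
    then show "\<exists>s. greatest (rev_incl F) s (Lower (rev_incl F) {A, B})"
      using AB by (intro exI[of _ "\<Inter>{C \<in> F. A \<union> B \<subseteq> C}"]) (auto simp: greatest_def Lower_def)
  qed
qed

text \<open>Composing with a parametrization involves only the order, so automorphisms are wanted in
  order form. Reversing both sides lets plain inclusion replace \<open>rev_incl\<close>.\<close>

lemma OI_iff:
  "\<sigma> \<in> OI F \<longleftrightarrow>
    \<sigma> \<in> extensional F \<and> bij_betw \<sigma> F F \<and> (\<forall>A \<in> F. \<forall>B \<in> F. \<sigma> A \<subseteq> \<sigma> B \<longleftrightarrow> A \<subseteq> B)"
proof -
  interpret R: partial_order "rev_incl F" by (rule partial_order_rev_incl)
  have "\<sigma> \<in> OI F \<longleftrightarrow> \<sigma> \<in> extensional F \<and> bij_betw \<sigma> F F \<and> order_emb (rev_incl F) (rev_incl F) \<sigma>"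
    using lattice_hom_iff_order_emb[OF lattice_rev_incl, of \<sigma>]
    by (auto simp: OI_def lattice_automorphisms_def)
  then show ?thesis
    by (auto simp: order_emb_def R.weak_partial_order_axioms)
qed

lemma parametrizes_inj:
  assumes "parametrizes \<psi> P"
  shows "inj_on \<psi> F"
proof (rule inj_onI)
  fix A B assume AB: "A \<in> F" "B \<in> F" "\<psi> A = \<psi> B"
  have "\<psi> C \<sqsubseteq> \<psi> C" if "C \<in> F" for C
    using assms that by (simp add: parametrizes_def)
  then show "A = B"
    using assms AB unfolding parametrizes_def by (metis subset_antisym)
qed

text \<open>Inverting an isomorphism from \<open>P\<close> onto \<open>F\<close> gives a
  parametrization, and conversely.\<close>

lemma embeddable_copies_iff:
  "P \<in> embeddable_copies L F \<longleftrightarrow>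
    P \<subseteq> carrier L \<and> (\<forall>S \<subseteq> P. \<Sqinter> S \<in> P) \<and> (\<exists>\<psi>. parametrizes \<psi> P)"
proof -
  have "order_isomorphic (L\<lparr>carrier := P\<rparr>) (rev_incl F) \<longleftrightarrow> (\<exists>\<psi>. parametrizes \<psi> P)"
    if P: "P \<subseteq> carrier L"
  proof
    assume "order_isomorphic (L\<lparr>carrier := P\<rparr>) (rev_incl F)"
    then obtain \<phi> where \<phi>: "bij_betw \<phi> P F" "\<And>x y. x \<in> P \<Longrightarrow> y \<in> P \<Longrightarrow> \<phi> y \<subseteq> \<phi> x \<longleftrightarrow> x \<sqsubseteq> y"
      by (auto simp: order_isomorphic_def order_emb_def)
    have bij: "bij_betw (inv_into P \<phi>) F P"
      by (rule bij_betw_inv_into[OF \<phi>(1)])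
    have "inv_into P \<phi> A \<sqsubseteq> inv_into P \<phi> B \<longleftrightarrow> B \<subseteq> A" if "A \<in> F" "B \<in> F" for A B
      using \<phi>(2)[of "inv_into P \<phi> A" "inv_into P \<phi> B"] that bij_betwE[OF bij]
      by (simp add: bij_betw_inv_into_right[OF \<phi>(1)])
    with bij show "\<exists>\<psi>. parametrizes \<psi> P"
      by (intro exI[of _ "inv_into P \<phi>"]) (simp add: parametrizes_def bij_betw_def)
  next
    assume "\<exists>\<psi>. parametrizes \<psi> P"
    then obtain \<psi> where \<psi>: "parametrizes \<psi> P" by blast
    have bij: "bij_betw \<psi> F P"
      using parametrizes_inj[OF \<psi>] \<psi> by (simp add: bij_betw_def parametrizes_def)
    interpret Q: partial_order "L\<lparr>carrier := P\<rparr>" by (rule partial_order_subset[OF P])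
    interpret R: partial_order "rev_incl F" by (rule partial_order_rev_incl)
    have "inv_into F \<psi> y \<subseteq> inv_into F \<psi> x \<longleftrightarrow> x \<sqsubseteq> y" if "x \<in> P" "y \<in> P" for x y
    proof -
      have "inv_into F \<psi> x \<in> F" "inv_into F \<psi> y \<in> F"
        using that bij_betwE[OF bij_betw_inv_into[OF bij]] by auto
      then have "\<psi> (inv_into F \<psi> x) \<sqsubseteq> \<psi> (inv_into F \<psi> y) \<longleftrightarrow> inv_into F \<psi> y \<subseteq> inv_into F \<psi> x"
        using \<psi> by (simp add: parametrizes_def)
      then show ?thesis
        using that by (simp add: bij_betw_inv_into_right[OF bij])
    qed
    then show "order_isomorphic (L\<lparr>carrier := P\<rparr>) (rev_incl F)"
      unfolding order_isomorphic_def order_emb_def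
      using bij_betw_inv_into[OF bij] Q.weak_partial_order_axioms R.weak_partial_order_axioms
      by (intro exI[of _ "inv_into F \<psi>"]) simp
  qed
  then show ?thesis
    by (auto simp: embeddable_copies_def iota_embeddable_iff)
qed

text \<open>Closure under infima lets every \<open>p\<close> be rounded up to some
  \<open>\<psi> A\<close> without changing its cut, so no cut falls outside \<open>F\<close>. The
  second claim recovers \<open>\<psi>\<close> on \<open>F\<close> from the fuzzy set, which later
  gives injectivity.\<close>

lemma
  assumes P: "P \<subseteq> carrier L" "\<forall>S \<subseteq> P. \<Sqinter> S \<in> P" and \<psi>: "parametrizes \<psi> P"
  shows fuzzy_of_in: "fuzzy_of \<psi> \<in> fuzzy_sets X L F"
    and inf_fuzzy_of: "A \<in> F \<Longrightarrow> \<Sqinter> (fuzzy_of \<psi> ` A) = \<psi> A"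
proof -
  define f where "f = fuzzy_of \<psi>"
  have \<psi>P: "\<psi> A \<in> P" if "A \<in> F" for A
    using \<psi> that by (auto simp: parametrizes_def)
  have \<psi>le: "\<psi> A \<sqsubseteq> \<psi> B \<longleftrightarrow> B \<subseteq> A" if "A \<in> F" "B \<in> F" for A B
    using \<psi> that by (auto simp: parametrizes_def)
  have f: "f \<in> X \<rightarrow>\<^sub>E carrier L"
    using \<psi>P P(1) hull_pt_in by (auto simp: f_def fuzzy_of_def)
  have cut\<psi>: "cut X L f (\<psi> A) = A" if A: "A \<in> F" for A
    using A F_Pow by (auto simp: cut_def f_def fuzzy_of_def \<psi>le hull_pt_in hull_pt_subset_iff)
  \<comment> \<open>The least element of P above p has the same cut as p.\<close>
  have ex: "\<exists>A \<in> F. p \<sqsubseteq> \<psi> A \<and> cut X L f p = A" if p: "p \<in> carrier L" for p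
  proof -
    let ?U = "{r \<in> P. p \<sqsubseteq> r}"
    have U: "?U \<subseteq> carrier L" using P(1) by auto
    have "\<Sqinter> ?U \<in> P" using P(2) by auto
    then obtain A where A: "A \<in> F" "\<psi> A = \<Sqinter> ?U"
      using \<psi> by (auto simp: parametrizes_def)
    have pA: "p \<sqsubseteq> \<psi> A"
      unfolding A(2) using p U by (intro inf_greatest) auto
    have "p \<sqsubseteq> r \<longleftrightarrow> \<psi> A \<sqsubseteq> r" if "r \<in> P" for r
    proof
      assume "p \<sqsubseteq> r"
      then show "\<psi> A \<sqsubseteq> r"
        unfolding A(2) using U that by (intro inf_lower) auto
    next
      assume "\<psi> A \<sqsubseteq> r"
      then show "p \<sqsubseteq> r"
        using le_trans[OF pA \<open>\<psi> A \<sqsubseteq> r\<close> p] that P(1) \<psi>P[OF A(1)] by auto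
    qed
    \<comment> \<open>All values of \<open>f\<close> lie in \<open>P\<close>, so comparisons with
      members of \<open>P\<close> determine the cut.\<close>
    then have "cut X L f p = cut X L f (\<psi> A)"
      using \<psi>P hull_pt_in by (auto simp: cut_def f_def fuzzy_of_def)
    then show ?thesis
      using A(1) pA cut\<psi>[OF A(1)] by (intro bexI[of _ A]) simp_all
  qed
  have "cuts X L f = F"
  proof
    show "cuts X L f \<subseteq> F"
      using ex by (auto simp: cuts_def)
    show "F \<subseteq> cuts X L f"
    proof
      fix A assume "A \<in> F"
      then have "A = cut X L f (\<psi> A)" "\<psi> A \<in> carrier L"
        using cut\<psi> \<psi>P P(1) by auto
      then show "A \<in> cuts X L f"
        unfolding cuts_def by blast
    qed
  qed
  with f show "fuzzy_of \<psi> \<in> fuzzy_sets X L F"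
    by (simp add: fuzzy_sets_def f_def)
  show "\<Sqinter> (fuzzy_of \<psi> ` A) = \<psi> A" if A: "A \<in> F"
  proof -
    have AX: "A \<subseteq> X" using A F_Pow by auto
    have fc: "f \<in> X \<rightarrow> carrier L" using f by auto
    have fA: "f ` A \<subseteq> carrier L" using fc AX by auto
    have c: "\<psi> A \<in> carrier L" "\<Sqinter> (f ` A) \<in> carrier L"
      using \<psi>P[OF A] P(1) inf_closed[OF fA] by auto
    \<comment> \<open>Rounding up the infimum over \<open>A\<close> gives \<open>\<psi> B\<close>,
      where \<open>B\<close> is its cut. Since \<open>B\<close> contains \<open>A\<close> and
      \<open>\<psi>\<close> reverses inclusion, the infimum is at most
      \<open>\<psi> A\<close>.\<close>
    obtain B where B: "B \<in> F" "\<Sqinter> (f ` A) \<sqsubseteq> \<psi> B" "cut X L f (\<Sqinter> (f ` A)) = B"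
      using ex c(2) by blast
    have "A \<subseteq> B"
      using le_inf_image_iff[OF fc AX c(2)] B(3) c(2) by simp
    then have "\<psi> B \<sqsubseteq> \<psi> A" using A B(1) by (simp add: \<psi>le)
    then have "\<Sqinter> (f ` A) \<sqsubseteq> \<psi> A"
      using le_trans[OF B(2)] c \<psi>P[OF B(1)] P(1) by auto
    moreover have "\<psi> A \<sqsubseteq> \<Sqinter> (f ` A)"
      using le_inf_image_iff[OF fc AX c(1)] cut\<psi>[OF A] by simp
    ultimately show ?thesis
      using c by (simp add: le_antisym f_def)
  qed
qed

section \<open>Recovering a copy of \<open>F\<close> and its parametrization from a fuzzy
  set\<close>

context
  fixes f assumes f: "f \<in> fuzzy_sets X L F"
begin

lemma f_funcset: "f \<in> X \<rightarrow> carrier L"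
  using f by (auto simp: fuzzy_sets_def)

lemma inf_cut_closed: "A \<in> F \<Longrightarrow> \<Sqinter> (f ` A) \<in> carrier L"
  using f_funcset F_Pow by (intro inf_closed) auto

lemma cut_in: "p \<in> carrier L \<Longrightarrow> cut X L f p \<in> F"
  using f by (auto simp: fuzzy_sets_def cuts_def)

text \<open>If \<open>A\<close> is the cut at \<open>p\<close>, then \<open>p\<close> is below the
  infimum of \<open>f\<close> over \<open>A\<close>, and raising the threshold only shrinks the cut.
  So this infimum is the largest threshold with cut \<open>A\<close>.\<close>

lemma cut_inf:
  assumes A: "A \<in> F"
  shows "cut X L f (\<Sqinter> (f ` A)) = A"
proof
  have AX: "A \<subseteq> X" using A F_Pow by auto
  note iff = le_inf_image_iff[OF f_funcset AX]
  show "A \<subseteq> cut X L f (\<Sqinter> (f ` A))"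
    using iff[OF inf_cut_closed[OF A]] inf_cut_closed[OF A] by simp
  obtain p where p: "p \<in> carrier L" "A = cut X L f p"
    using f A by (auto simp: fuzzy_sets_def cuts_def)
  then have "p \<sqsubseteq> \<Sqinter> (f ` A)" using iff[of p] by simp
  then show "cut X L f (\<Sqinter> (f ` A)) \<subseteq> A"
    unfolding p(2)
    using p f_funcset inf_cut_closed[OF A] by (auto simp: cut_def intro: le_trans)
qed

lemma inf_cut_le_iff:
  assumes "p \<in> carrier L" "A \<in> F"
  shows "p \<sqsubseteq> \<Sqinter> (f ` A) \<longleftrightarrow> A \<subseteq> cut X L f p"
  using assms F_Pow by (intro le_inf_image_iff[OF f_funcset]) auto

lemma parametrizes_inf: "parametrizes (\<lambda>A. \<Sqinter> (f ` A)) ((\<lambda>A. \<Sqinter> (f ` A)) ` F)"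
  by (simp add: parametrizes_def inf_cut_le_iff inf_cut_closed cut_inf)

lemma inf_image_in_embeddable_copies: "(\<lambda>A. \<Sqinter> (f ` A)) ` F \<in> embeddable_copies L F"
proof -
  let ?P = "(\<lambda>A. \<Sqinter> (f ` A)) ` F"
  have P: "?P \<subseteq> carrier L" using inf_cut_closed by auto
  have "\<Sqinter> S \<in> ?P" if S: "S \<subseteq> ?P" for S
  proof -
    have Sc: "S \<subseteq> carrier L" using S P by auto
    \<comment> \<open>Passing from a point to the infimum of \<open>f\<close> over its cut can only
      raise it. Here the result is still a lower bound of \<open>S\<close>, so nothing is
      raised.\<close>
    define A where "A = cut X L f (\<Sqinter> S)"
    have m: "\<Sqinter> S \<in> carrier L" by (rule inf_closed[OF Sc])
    have A: "A \<in> F" unfolding A_def by (rule cut_in[OF m])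
    have "\<Sqinter> (f ` A) \<sqsubseteq> s" if s: "s \<in> S" for s
    proof -
      obtain B where B: "B \<in> F" "s = \<Sqinter> (f ` B)" using s S by auto
      have "\<Sqinter> S \<sqsubseteq> s" by (rule inf_lower[OF Sc s])
      then have "B \<subseteq> A"
        unfolding B(2) A_def using inf_cut_le_iff[OF m B(1)] by simp
      then show ?thesis
        unfolding B(2) using inf_cut_le_iff[OF inf_cut_closed[OF A] B(1)] cut_inf[OF A] by simp
    qed
    then have "\<Sqinter> (f ` A) \<sqsubseteq> \<Sqinter> S"
      using Sc inf_cut_closed[OF A] by (intro inf_greatest) auto
    moreover have "\<Sqinter> S \<sqsubseteq> \<Sqinter> (f ` A)"
      using inf_cut_le_iff[OF m A] by (simp add: A_def)
    ultimately have "\<Sqinter> S = \<Sqinter> (f ` A)"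
      using m inf_cut_closed[OF A] by (intro le_antisym)
    with A show ?thesis by blast
  qed
  with P parametrizes_inf show ?thesis
    by (auto simp only: embeddable_copies_iff)
qed

text \<open>The cut at \<open>f x\<close> is a member of \<open>F\<close> containing
  \<open>x\<close>, hence contains \<open>hull_pt x\<close>. So \<open>f\<close> is at least
  \<open>f x\<close> on \<open>hull_pt x\<close>, and \<open>x\<close> itself attains this
  bound.\<close>

lemma fuzzy_of_inf: "fuzzy_of (\<lambda>A. \<Sqinter> (f ` A)) = f"
proof (rule extensionalityI[of _ X])
  fix x assume x: "x \<in> X"
  have fx: "f x \<in> carrier L" using f_funcset x by auto
  have H: "hull_pt x \<in> F" by (rule hull_pt_in[OF x])
  then have HX: "f ` hull_pt x \<subseteq> carrier L" using f_funcset F_Pow by auto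
  have "x \<in> hull_pt x" by (simp add: hull_pt_def)
  then have "\<Sqinter> (f ` hull_pt x) \<sqsubseteq> f x" using HX by (intro inf_lower) auto
  moreover have "x \<in> cut X L f (f x)" using x fx by (simp add: cut_def)
  then have "f x \<sqsubseteq> \<Sqinter> (f ` hull_pt x)"
    using inf_cut_le_iff[OF fx H] hull_pt_subset_iff[OF cut_in[OF fx]] by simp
  ultimately show "fuzzy_of (\<lambda>A. \<Sqinter> (f ` A)) x = f x"
    using x fx inf_cut_closed[OF H] by (simp add: fuzzy_of_def le_antisym)
qed (use f in \<open>auto simp: fuzzy_of_def fuzzy_sets_def PiE_def\<close>)

end

section \<open>The bijection between pairs and fuzzy sets\<close>

definition std_param :: "'l set \<Rightarrow> 'x set \<Rightarrow> 'l"
  where "std_param P = (SOME \<psi>. parametrizes \<psi> P)"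

lemma parametrizes_std_param: "P \<in> embeddable_copies L F \<Longrightarrow> parametrizes (std_param P) P"
  unfolding std_param_def embeddable_copies_iff
  using someI_ex[of "\<lambda>\<psi>. parametrizes \<psi> P"] by blast

lemma parametrizes_comp:
  assumes "parametrizes \<psi> P" "\<sigma> \<in> OI F"
  shows "parametrizes (\<psi> \<circ> \<sigma>) P"
proof -
  have \<sigma>: "\<sigma> ` F = F" using assms(2) by (simp add: OI_iff bij_betw_def)
  then have "\<sigma> A \<in> F" if "A \<in> F" for A using that by auto
  then show ?thesis
    using assms unfolding parametrizes_def OI_iff image_comp[symmetric] \<sigma> by simp
qed

text \<open>Two isomorphisms from \<open>F\<close> onto \<open>P\<close> differ by the automorphism
  that applies one and then the inverse of the other. With \<open>parametrizes_comp\<close>,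
  \<open>OI F\<close> thus acts transitively on the parametrizations of \<open>P\<close>, up to
  values outside \<open>F\<close>.\<close>

lemma parametrizes_factor:
  assumes \<psi>: "parametrizes \<psi> P" and \<chi>: "parametrizes \<chi> P"
  shows "\<exists>\<sigma> \<in> OI F. \<forall>A \<in> F. \<psi> (\<sigma> A) = \<chi> A"
proof -
  have bij: "bij_betw \<psi> F P" "bij_betw \<chi> F P"
    using parametrizes_inj[OF \<psi>] parametrizes_inj[OF \<chi>] \<psi> \<chi>
    by (simp_all add: bij_betw_def parametrizes_def)
  \<comment> \<open>The restriction supplies the extensionality required of members of
    \<open>OI F\<close>.\<close>
  define \<sigma> where "\<sigma> = restrict (inv_into F \<psi> \<circ> \<chi>) F"
  have eq: "\<psi> (\<sigma> A) = \<chi> A" if "A \<in> F" for A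
    using that bij_betw_inv_into_right[OF bij(1)] bij_betwE[OF bij(2)] by (simp add: \<sigma>_def)
  have bij\<sigma>: "bij_betw \<sigma> F F"
    using bij_betw_trans[OF bij(2) bij_betw_inv_into[OF bij(1)]]
    unfolding \<sigma>_def by (subst bij_betw_cong[of F _ "inv_into F \<psi> \<circ> \<chi>"]) auto
  have "\<sigma> A \<subseteq> \<sigma> B \<longleftrightarrow> A \<subseteq> B" if AB: "A \<in> F" "B \<in> F" for A B
  proof -
    have "\<sigma> A \<subseteq> \<sigma> B \<longleftrightarrow> \<psi> (\<sigma> B) \<sqsubseteq> \<psi> (\<sigma> A)"
      using \<psi> AB bij_betwE[OF bij\<sigma>] by (simp add: parametrizes_def)
    then show ?thesis
      using \<chi> AB by (simp add: eq parametrizes_def)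
  qed
  then have "\<sigma> \<in> OI F"
    using bij\<sigma> by (simp add: OI_iff \<sigma>_def)
  with eq show ?thesis by blast
qed

lemma fuzzy_of_cong: "(\<And>A. A \<in> F \<Longrightarrow> \<psi> A = \<chi> A) \<Longrightarrow> fuzzy_of \<psi> = fuzzy_of \<chi>"
  by (auto simp: fuzzy_of_def hull_pt_in)

lemma bij_betw_fuzzy_of:
  "bij_betw (\<lambda>(P, \<sigma>). fuzzy_of (std_param P \<circ> \<sigma>)) (embeddable_copies L F \<times> OI F) (fuzzy_sets X L F)"
  unfolding bij_betw_def
proof
  have par: "parametrizes (std_param P \<circ> \<sigma>) P" if "P \<in> embeddable_copies L F" "\<sigma> \<in> OI F" for P \<sigma>
    using that parametrizes_std_param parametrizes_comp by blast
  show "inj_on (\<lambda>(P, \<sigma>). fuzzy_of (std_param P \<circ> \<sigma>)) (embeddable_copies L F \<times> OI F)"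
  proof (rule inj_onI, clarify)
    fix P \<sigma> Q \<tau>
    assume P: "P \<in> embeddable_copies L F" and \<sigma>: "\<sigma> \<in> OI F"
      and Q: "Q \<in> embeddable_copies L F" and \<tau>: "\<tau> \<in> OI F"
      and eq: "fuzzy_of (std_param P \<circ> \<sigma>) = fuzzy_of (std_param Q \<circ> \<tau>)"
    \<comment> \<open>Infima over the members of \<open>F\<close> recover both parametrizations from
      the common fuzzy set; their ranges are \<open>P\<close> and \<open>Q\<close>.\<close>
    have *: "std_param P (\<sigma> A) = std_param Q (\<tau> A)" if "A \<in> F" for A
      using inf_fuzzy_of[OF _ _ par[OF P \<sigma>] that] inf_fuzzy_of[OF _ _ par[OF Q \<tau>] that] eq P Q
      by (simp add: embeddable_copies_iff)
    have "P = (\<lambda>A. std_param P (\<sigma> A)) ` F" "Q = (\<lambda>A. std_param Q (\<tau> A)) ` F"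
      using par[OF P \<sigma>] par[OF Q \<tau>] by (auto simp: parametrizes_def)
    then have PQ: "P = Q" using * by simp
    have inj: "inj_on (std_param P) F"
      by (rule parametrizes_inj[OF parametrizes_std_param[OF P]])
    have "\<sigma> = \<tau>"
    proof (rule extensionalityI[of _ F])
      fix A assume A: "A \<in> F"
      then have "\<sigma> A \<in> F" "\<tau> A \<in> F"
        using \<sigma> \<tau> by (auto simp: OI_iff dest: bij_betwE)
      then show "\<sigma> A = \<tau> A"
        using *[OF A] PQ inj by (auto dest: inj_onD)
    qed (use \<sigma> \<tau> in \<open>simp_all add: OI_iff\<close>)
    with PQ show "P = Q \<and> \<sigma> = \<tau>" by simp
  qed
  show "(\<lambda>(P, \<sigma>). fuzzy_of (std_param P \<circ> \<sigma>)) ` (embeddable_copies L F \<times> OI F) = fuzzy_sets X L F"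
  proof
    show "(\<lambda>(P, \<sigma>). fuzzy_of (std_param P \<circ> \<sigma>)) ` (embeddable_copies L F \<times> OI F) \<subseteq> fuzzy_sets X L F"
    proof clarify
      fix P \<sigma> assume "P \<in> embeddable_copies L F" "\<sigma> \<in> OI F"
      then show "fuzzy_of (std_param P \<circ> \<sigma>) \<in> fuzzy_sets X L F"
        by (intro fuzzy_of_in[OF _ _ par]) (simp_all add: embeddable_copies_iff)
    qed
    show "fuzzy_sets X L F \<subseteq> (\<lambda>(P, \<sigma>). fuzzy_of (std_param P \<circ> \<sigma>)) ` (embeddable_copies L F \<times> OI F)"
    proof
      fix f assume f: "f \<in> fuzzy_sets X L F"
      define P where "P = (\<lambda>A. \<Sqinter> (f ` A)) ` F"
      have P: "P \<in> embeddable_copies L F" "parametrizes (\<lambda>A. \<Sqinter> (f ` A)) P"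
        unfolding P_def using inf_image_in_embeddable_copies[OF f] parametrizes_inf[OF f] by auto
      obtain \<sigma> where \<sigma>: "\<sigma> \<in> OI F" "\<forall>A \<in> F. std_param P (\<sigma> A) = \<Sqinter> (f ` A)"
        using parametrizes_factor[OF parametrizes_std_param[OF P(1)] P(2)] by auto
      have "f = fuzzy_of (std_param P \<circ> \<sigma>)"
        using fuzzy_of_cong[of "std_param P \<circ> \<sigma>" "\<lambda>A. \<Sqinter> (f ` A)"] \<sigma>(2) fuzzy_of_inf[OF f] by simp
      with P(1) \<sigma>(1) show "f \<in> (\<lambda>(P, \<sigma>). fuzzy_of (std_param P \<circ> \<sigma>)) ` (embeddable_copies L F \<times> OI F)"
        by auto
    qed
  qed
qed

end

theorem theorem9:
  fixes X :: "'x set" and F :: "'x set set" and L :: "('l, 'm) gorder_scheme"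
  assumes "X \<noteq> {}"
    and "F \<subseteq> Pow X"
    and "\<And>G. G \<subseteq> F \<Longrightarrow> G \<noteq> {} \<Longrightarrow> \<Inter>G \<in> F"
    and "X \<in> F"
    and "complete_lattice L"
  shows "|fuzzy_sets X L F| =o |embeddable_copies L F| *c |OI F|"
proof -
  interpret complete_lattice L by (rule assms(5))
  interpret fuzzy_cuts L X F
    by unfold_locales (use assms in auto)
  have "|embeddable_copies L F \<times> OI F| =o |fuzzy_sets X L F|"
    using bij_betw_fuzzy_of card_of_ordIso by blast
  then show ?thesis
    \<comment> \<open>The cardinal product is the cardinality of the Cartesian product of the
      fields, and the field of \<open>|A|\<close> is \<open>A\<close>.\<close>
    unfolding cprod_def Field_card_of by (rule ordIso_symmetric)
qed

end
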